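(* Let $X$ be a metrizable space. If $\mathrm{Met}(X)$ is a Borel subset of $\mathrm{CPM}(X)$, then $X$ is separable.
   Context: For a topological space $X$, a continuous pseudometric on $X$ is a continuous map $d\colon X\times X\to[0,\infty)$ such that $d(x,x)=0$, $d(x,y)=d(y,x)$ and $d(x,z)\le d(x,y)+d(y,z)$ for all $x,y,z\in X$. $\mathrm{CPM}(X)$ denotes the set of all continuous pseudometrics on $X$, equipped with the topology induced by the supremum metric $\mathcal{D}_X(d,e)=\sup_{(x,y)\in X^2}|d(x,y)-e(x,y)|\in[0,\infty]$ (equivalently, by the metric $\min\{\mathcal{D}_X,1\}$). For a metrizable space $X$, $\mathrm{Met}(X)\subseteq \mathrm{CPM}(X)$ is the set of all metrics on $X$ that induce the topology of $X$. *)

theory Defs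
  imports "HOL-Analysis.Analysis"
begin

text \<open>
  Spaces are abstract topologies, so that the empty space is included.  A function on
  \<open>topspace X \<times> topspace X\<close> is represented by its extension by 0 to the whole type, which makes
  the representation unique.  The value 0 (rather than \<^term>\<open>undefined\<close>) is used because the library
  locale \<^locale>\<open>Metric_space\<close> requires nonnegativity and symmetry also off the carrier.
\<close>

definition zero_outside :: "'a set \<Rightarrow> ('a \<Rightarrow> 'a \<Rightarrow> real) \<Rightarrow> bool" where
  "zero_outside S d \<longleftrightarrow> (\<forall>x y. \<not> (x \<in> S \<and> y \<in> S) \<longrightarrow> d x y = 0)"

definition continuous_pseudometric :: "'a topology \<Rightarrow> ('a \<Rightarrow> 'a \<Rightarrow> real) \<Rightarrow> bool" where
  "continuous_pseudometric X d \<longleftrightarrow>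
     continuous_map (prod_topology X X) euclideanreal (\<lambda>(x, y). d x y) \<and>
     (\<forall>x\<in>topspace X. \<forall>y\<in>topspace X. 0 \<le> d x y) \<and>
     (\<forall>x\<in>topspace X. d x x = 0) \<and>
     (\<forall>x\<in>topspace X. \<forall>y\<in>topspace X. d x y = d y x) \<and>
     (\<forall>x\<in>topspace X. \<forall>y\<in>topspace X. \<forall>z\<in>topspace X. d x z \<le> d x y + d y z)"

definition CPM :: "'a topology \<Rightarrow> ('a \<Rightarrow> 'a \<Rightarrow> real) set" where
  "CPM X = {d. continuous_pseudometric X d \<and> zero_outside (topspace X) d}"

definition cpm_sup :: "'a topology \<Rightarrow> ('a \<Rightarrow> 'a \<Rightarrow> real) \<Rightarrow> ('a \<Rightarrow> 'a \<Rightarrow> real) \<Rightarrow> ennreal" where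
  "cpm_sup X d e = (SUP (x, y) \<in> topspace X \<times> topspace X. ennreal \<bar>d x y - e x y\<bar>)"

definition cpm_dist :: "'a topology \<Rightarrow> ('a \<Rightarrow> 'a \<Rightarrow> real) \<Rightarrow> ('a \<Rightarrow> 'a \<Rightarrow> real) \<Rightarrow> real" where
  "cpm_dist X d e = enn2real (min (cpm_sup X d e) 1)"

definition cpm_topology :: "'a topology \<Rightarrow> ('a \<Rightarrow> 'a \<Rightarrow> real) topology" where
  "cpm_topology X = Metric_space.mtopology (CPM X) (cpm_dist X)"

definition Met :: "'a topology \<Rightarrow> ('a \<Rightarrow> 'a \<Rightarrow> real) set" where
  "Met X = {d. Metric_space (topspace X) d \<and> Metric_space.mtopology (topspace X) d = X \<and>
               zero_outside (topspace X) d}"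

definition borel_sets_of :: "'a topology \<Rightarrow> 'a set set" where
  "borel_sets_of T = sigma_sets (topspace T) {U. openin T U}"


lemma cpm_sup_commute: "cpm_sup X d e = cpm_sup X e d"
  unfolding cpm_sup_def by (simp add: abs_minus_commute)

lemma cpm_sup_upper:
  assumes "x \<in> topspace X" "y \<in> topspace X"
  shows "ennreal \<bar>d x y - e x y\<bar> \<le> cpm_sup X d e"
  unfolding cpm_sup_def using assms by (intro SUP_upper2[of "(x, y)"]) auto

lemma cpm_sup_triangle: "cpm_sup X d f \<le> cpm_sup X d e + cpm_sup X e f"
proof -
  have "ennreal \<bar>d x y - f x y\<bar> \<le> cpm_sup X d e + cpm_sup X e f"
    if "x \<in> topspace X" "y \<in> topspace X" for x y
  proof -
    have "ennreal \<bar>d x y - f x y\<bar> \<le> ennreal (\<bar>d x y - e x y\<bar> + \<bar>e x y - f x y\<bar>)"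
      by (intro ennreal_leI) linarith
    also have "\<dots> = ennreal \<bar>d x y - e x y\<bar> + ennreal \<bar>e x y - f x y\<bar>"
      by simp
    also have "\<dots> \<le> cpm_sup X d e + cpm_sup X e f"
      using that by (intro add_mono cpm_sup_upper)
    finally show ?thesis .
  qed
  then show ?thesis
    unfolding cpm_sup_def[of X d f] by (intro SUP_least) auto
qed

lemma ennreal_cpm_dist: "ennreal (cpm_dist X d e) = min (cpm_sup X d e) 1"
  unfolding cpm_dist_def by (rule ennreal_enn2real) (simp add: min_less_iff_disj)

lemma cpm_dist_less_iff:
  assumes "0 < r" "r \<le> 1"
  shows "cpm_dist X d e < r \<longleftrightarrow> cpm_sup X d e < ennreal r"
proof -
  have "cpm_dist X d e < r \<longleftrightarrow> ennreal (cpm_dist X d e) < ennreal r"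
    by (simp add: cpm_dist_def ennreal_less_iff)
  also have "\<dots> \<longleftrightarrow> cpm_sup X d e < ennreal r"
    using assms by (auto simp: ennreal_cpm_dist min_less_iff_disj)
  finally show ?thesis .
qed

lemma Metric_space_cpm: "Metric_space (CPM X) (cpm_dist X)"
proof
  fix d e f
  show "0 \<le> cpm_dist X d e"
    by (simp add: cpm_dist_def)
  show "cpm_dist X d e = cpm_dist X e d"
    by (simp add: cpm_dist_def cpm_sup_commute[of X d e])
  show "cpm_dist X d f \<le> cpm_dist X d e + cpm_dist X e f"
  proof -
    have "min (a::ennreal) 1 \<le> min b 1 + min c 1" if "a \<le> b + c" for a b c
      using that by (auto simp: min_def intro: order_trans)
    then have "ennreal (cpm_dist X d f) \<le> ennreal (cpm_dist X d e) + ennreal (cpm_dist X e f)"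
      unfolding ennreal_cpm_dist using cpm_sup_triangle by blast
    also have "\<dots> = ennreal (cpm_dist X d e + cpm_dist X e f)"
      by (simp add: cpm_dist_def)
    finally show ?thesis
      using ennreal_le_iff[of "cpm_dist X d e + cpm_dist X e f"] by (simp add: cpm_dist_def)
  qed
  assume *: "d \<in> CPM X" "e \<in> CPM X"
  show "cpm_dist X d e = 0 \<longleftrightarrow> d = e"
  proof
    assume "cpm_dist X d e = 0"
    then have "min (cpm_sup X d e) 1 = 0"
      by (metis ennreal_0 ennreal_cpm_dist)
    then have "cpm_sup X d e = 0"
      by (auto simp: min_def split: if_splits)
    then have "d x y = e x y" if "x \<in> topspace X" "y \<in> topspace X" for x y
      using cpm_sup_upper[OF that, of d e] by (simp add: ennreal_eq_0_iff)
    moreover have "d x y = e x y" if "\<not> (x \<in> topspace X \<and> y \<in> topspace X)" for x y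
      using * that unfolding CPM_def zero_outside_def by auto
    ultimately show "d = e" by blast
  next
    assume "d = e"
    then have "cpm_sup X d e = 0"
      unfolding cpm_sup_def by (simp add: SUP_eq_iff case_prod_beta flip: bot_ennreal)
    then show "cpm_dist X d e = 0"
      by (simp add: cpm_dist_def)
  qed
qed

text \<open>The topology on \<^term>\<open>CPM X\<close> is the one induced by the \<open>[0, \<infinity>]\<close>-valued supremum metric.\<close>

lemma openin_cpm_topology:
  "openin (cpm_topology X) U \<longleftrightarrow>
     U \<subseteq> CPM X \<and> (\<forall>d\<in>U. \<exists>r>0. \<forall>e\<in>CPM X. cpm_sup X d e < ennreal r \<longrightarrow> e \<in> U)"
proof -
  interpret Metric_space "CPM X" "cpm_dist X" by (rule Metric_space_cpm)
  have "(\<exists>r>0. mball d r \<subseteq> U) \<longleftrightarrow>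
        (\<exists>r>0. \<forall>e\<in>CPM X. cpm_sup X d e < ennreal r \<longrightarrow> e \<in> U)" if d: "d \<in> CPM X" for d
  proof
    assume "\<exists>r>0. mball d r \<subseteq> U"
    then obtain r where "r > 0" and r: "mball d r \<subseteq> U" by blast
    have "e \<in> U" if "e \<in> CPM X" "cpm_sup X d e < ennreal (min r 1)" for e
      using cpm_dist_less_iff[of "min r 1" X d e] that d r \<open>r > 0\<close> by auto
    then show "\<exists>r>0. \<forall>e\<in>CPM X. cpm_sup X d e < ennreal r \<longrightarrow> e \<in> U"
      using \<open>r > 0\<close> by (intro exI[of _ "min r 1"]) auto
  next
    assume "\<exists>r>0. \<forall>e\<in>CPM X. cpm_sup X d e < ennreal r \<longrightarrow> e \<in> U"
    then obtain r where "r > 0" and r: "\<And>e. e \<in> CPM X \<Longrightarrow> cpm_sup X d e < ennreal r \<Longrightarrow> e \<in> U"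
      by blast
    have "e \<in> U" if "e \<in> mball d (min r 1)" for e
    proof -
      have "cpm_sup X d e < ennreal (min r 1)"
        using cpm_dist_less_iff[of "min r 1" X d e] that \<open>r > 0\<close> by auto
      also have "\<dots> \<le> ennreal r" by (intro ennreal_leI) simp
      finally show ?thesis using r that by auto
    qed
    then show "\<exists>r>0. mball d r \<subseteq> U"
      using \<open>r > 0\<close> by (intro exI[of _ "min r 1"]) auto
  qed
  then show ?thesis
    unfolding cpm_topology_def openin_mtopology by blast
qed

lemma topspace_cpm_topology: "topspace (cpm_topology X) = CPM X"
  by (simp add: cpm_topology_def Metric_space.topspace_mtopology Metric_space_cpm)

lemma Met_subset_CPM: "Met X \<subseteq> CPM X"
proof
  fix d assume d: "d \<in> Met X"
  then interpret Metric_space "topspace X" d by (simp add: Met_def)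
  have X: "mtopology = X" using d by (simp add: Met_def)
  have "continuous_map (prod_topology X X) euclideanreal (\<lambda>p. d (fst p) (snd p))"
    using continuous_map_mdist[of "prod_topology X X" "metric (topspace X, d)" fst snd] X
    by (simp add: continuous_map_fst continuous_map_snd)
  then have "continuous_pseudometric X d"
    unfolding continuous_pseudometric_def
    using commute triangle by (auto simp: case_prod_unfold)
  then show "d \<in> CPM X" using d by (simp add: CPM_def Met_def)
qed

end

theory Submission
  imports Defs
begin

text \<open>
  Suppose \<open>X\<close> is not separable and fix a metric \<open>d\<close> inducing its topology.  Then there is an
  uncountable subset \<open>D\<close> that is \<open>\<epsilon>\<close>-separated for some \<open>\<epsilon> > 0\<close>.  In ZFC every uncountable cardinal
  bounds the size of some non-Borel set of reals: a set of size less than the continuum is non-Borel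
  as soon as it is uncountable, by the perfect set property.  Hence there is \<open>s : D \<rightarrow> \<real>\<close> with
  non-Borel range, and since \<open>D \<times> D\<close> and \<open>D\<close> are equinumerous all nonempty fibres may be taken to
  have at least two points.

  For real \<open>t\<close> attach to \<open>X\<close> a hub at distance \<open>\<bar>t - s i\<bar>\<close> from each \<open>i \<in> D\<close>, so that \<open>x\<close> has
  distance \<open>u t x = inf {d x i + \<bar>t - s i\<bar> | i \<in> D}\<close> from it, and let \<open>F t x y\<close> be the minimum of
  \<open>d x y\<close> and \<open>u t x + u t y\<close>.  If \<open>t\<close> is not in the range of \<open>s\<close>, then \<open>u t > 0\<close> everywhere and
  \<open>F t\<close> agrees locally with \<open>d\<close>; otherwise \<open>F t\<close> identifies two points of \<open>D\<close>.  As \<open>F\<close> is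
  2-Lipschitz for the supremum metric, the preimage of \<open>Met X\<close>, which is the complement of the
  range of \<open>s\<close>, would be Borel if \<open>Met X\<close> were.
\<close>

section \<open>Analytic sets\<close>

text \<open>
  The usual code space \<open>\<nat>\<^sup>\<nat>\<close> is replaced by \<open>\<real>\<^sup>\<nat>\<close>, because the type \<^typ>\<open>nat\<close> is not an instance
  of \<^class>\<open>metric_space\<close>.
\<close>

definition analytic :: "'a::topological_space set \<Rightarrow> bool" where
  "analytic A \<longleftrightarrow> (\<exists>C :: ('a \<times> (nat \<Rightarrow> real)) set. closed C \<and> A = fst ` C)"

lemma analytic_closed: "closed A \<Longrightarrow> analytic A"
  unfolding analytic_def
  by (rule exI[of _ "A \<times> UNIV"]) (auto intro: closed_Times)

text \<open>Countable set operations pack several codes into one sequence; extracting one of them is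
  a coordinate map, so closed conditions on it stay closed.\<close>

lemma closed_reindex:
  fixes C :: "('a::topological_space \<times> ('b \<Rightarrow> 'c::topological_space)) set"
  assumes "closed C"
  shows "closed {p :: 'a \<times> ('d \<Rightarrow> 'c). (fst p, \<lambda>k. snd p (h k)) \<in> C}"
proof -
  have "continuous_on UNIV (\<lambda>p :: 'a \<times> ('d \<Rightarrow> 'c). snd p (h k))" for k
    by (rule continuous_on_product_then_coordinatewise) (rule continuous_on_snd[OF continuous_on_id])
  then have "continuous_on UNIV (\<lambda>p :: 'a \<times> ('d \<Rightarrow> 'c). (fst p, \<lambda>k. snd p (h k)))"
    by (intro continuous_on_Pair continuous_on_fst continuous_on_id
        continuous_on_coordinatewise_then_product)
  then show ?thesis using closed_vimage[OF assms] by (simp add: vimage_def)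
qed

text \<open>Positive distance to the complement is an open condition, yet it is the projection of a
  closed one: some real \<open>z 0\<close> has product at least 1 with that distance.\<close>

lemma analytic_open:
  fixes A :: "'a::metric_space set"
  assumes "open A"
  shows "analytic A"
proof (cases "A = UNIV")
  \<comment> \<open>Treated apart because \<open>infdist\<close> to the empty complement is
    0.\<close>
  case True
  then show ?thesis by (simp add: analytic_closed)
next
  case False
  define C where "C = {(x, z :: nat \<Rightarrow> real). 1 \<le> infdist x (- A) * z 0}"
  have "continuous_on UNIV (\<lambda>p :: 'a \<times> (nat \<Rightarrow> real). snd p 0)"
    by (rule continuous_on_product_then_coordinatewise) (intro continuous_intros)
  then have "closed C"
    unfolding C_def case_prod_unfold by (intro closed_Collect_le continuous_intros)
  moreover have "A = fst ` C"
  proof (intro equalityI subsetI)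
    fix x assume "x \<in> A"
    then have "x \<notin> - A" by simp
    then have "infdist x (- A) > 0"
      using assms False infdist_pos_not_in_closed[of "- A" x] by (auto simp: closed_def)
    then obtain n :: nat where "1 \<le> infdist x (- A) * real n"
      by (metis less_eq_real_def mult.commute reals_Archimedean3)
    then have "(x, \<lambda>_. real n) \<in> C" by (simp add: C_def)
    then show "x \<in> fst ` C" by force
  next
    fix x assume "x \<in> fst ` C"
    then obtain z where "1 \<le> infdist x (- A) * z 0" by (auto simp: C_def)
    then have "infdist x (- A) \<noteq> 0" by force
    then show "x \<in> A" using infdist_zero[of x "- A"] by blast
  qed
  ultimately show ?thesis unfolding analytic_def by blast
qed

text \<open>Coordinate 0 of a code names an index \<open>n\<close>; the shifted sequence witnesses
  membership in \<open>A n\<close>.\<close>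

lemma analytic_UN:
  fixes A :: "nat \<Rightarrow> 'a::topological_space set"
  assumes "\<And>n. analytic (A n)"
  shows "analytic (\<Union>n. A n)"
proof -
  obtain C :: "nat \<Rightarrow> ('a \<times> (nat \<Rightarrow> real)) set"
    where C: "\<And>n. closed (C n)" "\<And>n. A n = fst ` C n"
    using assms unfolding analytic_def by metis
  \<comment> \<open>For naturals, distance below 1 means equality. Written this way the premise is
    open, so the implication defines a closed set.\<close>
  define E where "E = {p :: 'a \<times> (nat \<Rightarrow> real). snd p 0 \<in> \<nat> \<and>
    (\<forall>n. \<bar>snd p 0 - real n\<bar> < 1 \<longrightarrow> (fst p, \<lambda>k. snd p (Suc k)) \<in> C n)}"
  have coord: "continuous_on UNIV (\<lambda>p :: 'a \<times> (nat \<Rightarrow> real). snd p 0)"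
    by (rule continuous_on_product_then_coordinatewise) (intro continuous_intros)
  have "open {p :: 'a \<times> (nat \<Rightarrow> real). \<bar>snd p 0 - real n\<bar> < 1}" for n
    by (intro open_Collect_less continuous_intros coord)
  moreover have "closed {p :: 'a \<times> (nat \<Rightarrow> real). snd p 0 \<in> \<nat>}"
    using closed_vimage[OF closed_Nats coord] by (simp add: vimage_def)
  moreover have "closed {p :: 'a \<times> (nat \<Rightarrow> real). (fst p, \<lambda>k. snd p (Suc k)) \<in> C n}" for n
    by (rule closed_reindex[OF C(1)])
  ultimately have "closed E"
    unfolding E_def by (intro closed_Collect_conj closed_Collect_all closed_Collect_imp)
  moreover have "(\<Union>n. A n) = fst ` E"
  proof (intro equalityI subsetI)
    fix x assume "x \<in> (\<Union>n. A n)"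
    then obtain n z where "(x, z) \<in> C n" using C(2) by force
    moreover have "m = n" if "\<bar>real n - real m\<bar> < 1" for m
      using that by linarith
    ultimately have "(x, case_nat (real n) z) \<in> E" by (auto simp: E_def)
    then show "x \<in> fst ` E" by force
  next
    fix x assume "x \<in> fst ` E"
    then obtain z n where "z 0 = real n" "(x, \<lambda>k. z (Suc k)) \<in> C n"
      by (auto simp: E_def elim!: Nats_cases)
    then show "x \<in> (\<Union>n. A n)" using C(2) by force
  qed
  ultimately show ?thesis unfolding analytic_def by blast
qed

text \<open>A single code carries witnesses for all \<open>n\<close>, interleaved by the pairing
  function.\<close>

lemma analytic_INT:
  fixes A :: "nat \<Rightarrow> 'a::topological_space set"
  assumes "\<And>n. analytic (A n)"
  shows "analytic (\<Inter>n. A n)"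
proof -
  obtain C :: "nat \<Rightarrow> ('a \<times> (nat \<Rightarrow> real)) set"
    where C: "\<And>n. closed (C n)" "\<And>n. A n = fst ` C n"
    using assms unfolding analytic_def by metis
  define E where
    "E = {p :: 'a \<times> (nat \<Rightarrow> real). \<forall>n. (fst p, \<lambda>k. snd p (prod_encode (n, k))) \<in> C n}"
  have "closed {p :: 'a \<times> (nat \<Rightarrow> real). (fst p, \<lambda>k. snd p (prod_encode (n, k))) \<in> C n}" for n
    by (rule closed_reindex[OF C(1)])
  then have "closed E" unfolding E_def by (intro closed_Collect_all)
  moreover have "(\<Inter>n. A n) = fst ` E"
  proof (intro equalityI subsetI)
    fix x assume "x \<in> (\<Inter>n. A n)"
    then have "\<forall>n. \<exists>z. (x, z) \<in> C n" using C(2) by force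
    then obtain z where z: "\<And>n. (x, z n) \<in> C n" by metis
    have "(x, \<lambda>i. case prod_decode i of (n, k) \<Rightarrow> z n k) \<in> E" by (simp add: E_def z)
    then show "x \<in> fst ` E" by force
  next
    fix x assume "x \<in> fst ` E"
    then show "x \<in> (\<Inter>n. A n)" using C(2) by (force simp: E_def)
  qed
  ultimately show ?thesis unfolding analytic_def by blast
qed

text \<open>Analyticity need not pass to complements, so the induction carries \<open>A\<close> and
  \<open>- A\<close> together: complements swap the two claims.\<close>

lemma borel_imp_analytic:
  fixes A :: "'a::metric_space set"
  assumes "A \<in> sets borel"
  shows "analytic A"
proof -
  have "A \<in> sigma_sets UNIV (Collect open)" using assms by (simp add: sets_borel)
  then have "analytic A \<and> analytic (- A)"
  proof induction
    case (Union A)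
    then show ?case by (simp add: analytic_UN analytic_INT Compl_UN)
  qed (simp_all add: analytic_open analytic_closed Compl_eq_Diff_UNIV[symmetric] closed_Compl)
  then show ?thesis by simp
qed

section \<open>Perfect set property\<close>

text \<open>One branching step of a Cantor scheme. By Lindelof, the open pieces of \<open>C\<close>
  with countable image have countable image even together. Points over two other values have
  uncountable image near them, and disjoint neighbourhoods of the values keep the halves
  apart.\<close>

lemma uncountable_image_split:
  fixes f :: "'a::{metric_space, second_countable_topology} \<Rightarrow> 'b::t2_space"
  assumes f: "continuous_on UNIV f" and C: "closed C" "uncountable (f ` C)" and "\<epsilon> > 0"
  shows "\<exists>K. (\<forall>b::bool. closed (K b) \<and> K b \<subseteq> C \<and> uncountable (f ` K b) \<and>
               (\<forall>x\<in>K b. \<forall>y\<in>K b. dist x y < \<epsilon>)) \<and> f ` K True \<inter> f ` K False = {}"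
proof -
  define \<U> where "\<U> = {U. open U \<and> countable (f ` (C \<inter> U))}"
  obtain \<V> where \<V>: "\<V> \<subseteq> \<U>" "countable \<V>" "\<Union>\<V> = \<Union>\<U>"
    by (rule Lindelof[of \<U>]) (simp_all add: \<U>_def)
  define Y where "Y = f ` C - (\<Union>U\<in>\<V>. f ` (C \<inter> U))"
  have ne: "\<exists>x. x \<in> A" if "uncountable A" for A :: "'b set"
    using that countable_empty by (metis all_not_in_conv)
  have "countable (f ` (C \<inter> U))" if "U \<in> \<V>" for U
    using that \<V>(1) unfolding \<U>_def by blast
  then have "countable (\<Union>U\<in>\<V>. f ` (C \<inter> U))"
    using \<V>(2) by (intro countable_UN)
  then have unc: "uncountable Y"
    unfolding Y_def by (rule uncountable_minus_countable[OF C(2)])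
  then obtain y0 where y0: "y0 \<in> Y"
    using ne by blast
  have "uncountable (Y - {y0})"
    using unc by (intro uncountable_minus_countable) simp_all
  then obtain y1 where y1: "y1 \<in> Y" "y1 \<noteq> y0"
    using ne by blast
  obtain W0 W1 where W: "open W0" "open W1" "y0 \<in> W0" "y1 \<in> W1" "W0 \<inter> W1 = {}"
    using hausdorff[of y0 y1] y1(2) by blast
  have *: "\<exists>K. closed K \<and> K \<subseteq> C \<and> uncountable (f ` K) \<and> (\<forall>x\<in>K. \<forall>y\<in>K. dist x y < \<epsilon>) \<and> f ` K \<subseteq> W"
    if y: "y \<in> Y" "open W" "y \<in> W" for y W
  proof -
    obtain p where p: "p \<in> C" "f p = y" "p \<notin> \<Union>\<V>"
      using y(1) unfolding Y_def by blast
    have "open (f -` W)" using f y(2) by (simp add: open_vimage)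
    then obtain r where r: "r > 0" "cball p r \<subseteq> f -` W"
      using p(2) y(3) open_contains_cball by (metis vimageI)
    define s where "s = min r (\<epsilon> / 3)"
    have s: "s > 0" "s \<le> r" "2 * s < \<epsilon>" using r(1) \<open>\<epsilon> > 0\<close> by (auto simp: s_def)
    have "ball p s \<notin> \<U>" using p(3) \<V>(3) s(1) by (metis UnionI centre_in_ball)
    then have "uncountable (f ` (C \<inter> ball p s))" by (simp add: \<U>_def)
    moreover have "f ` (C \<inter> ball p s) \<subseteq> f ` (C \<inter> cball p s)" by auto
    ultimately have "uncountable (f ` (C \<inter> cball p s))" by (meson countable_subset)
    moreover have "dist x y < \<epsilon>" if "x \<in> C \<inter> cball p s" "y \<in> C \<inter> cball p s" for x y
      using that s(3) dist_triangle3[of x y p] by simp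
    moreover have "f ` (C \<inter> cball p s) \<subseteq> W" using r(2) s(2) by force
    moreover have "closed (C \<inter> cball p s)" using C(1) by (simp add: closed_Int)
    ultimately show ?thesis
      by (intro exI[of _ "C \<inter> cball p s"] conjI ballI Int_lower1)
  qed
  obtain K0 where K0: "closed K0" "K0 \<subseteq> C" "uncountable (f ` K0)"
      "\<forall>x\<in>K0. \<forall>y\<in>K0. dist x y < \<epsilon>" "f ` K0 \<subseteq> W0"
    using *[OF y0 W(1,3)] by (elim exE conjE)
  obtain K1 where K1: "closed K1" "K1 \<subseteq> C" "uncountable (f ` K1)"
      "\<forall>x\<in>K1. \<forall>y\<in>K1. dist x y < \<epsilon>" "f ` K1 \<subseteq> W1"
    using *[OF y1(1) W(2,4)] by (elim exE conjE)
  have "f ` K0 \<inter> f ` K1 = {}" using K0(5) K1(5) W(5) by blast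
  then show ?thesis
    using K0 K1 by (intro exI[of _ "\<lambda>b. if b then K0 else K1"]) simp
qed

text \<open>Cantor scheme: a set \<open>B\<close> of naturals selects at stage \<open>n\<close> the
  half named by the truth value of \<open>n \<in> B\<close>. Diameters shrink to 0, so completeness
  gives a point on each branch; at the first \<open>n\<close> where two sets differ, the selected
  halves have disjoint images.\<close>

lemma nat_sets_lepoll_uncountable_image:
  fixes f :: "'a::{complete_space, second_countable_topology} \<Rightarrow> 'b::t2_space"
  assumes f: "continuous_on UNIV f" and C: "closed C" "uncountable (f ` C)"
  shows "(UNIV :: nat set set) \<lesssim> f ` C"
proof -
  define P where "P D \<longleftrightarrow> closed D \<and> uncountable (f ` D)" for D
  define Q where "Q D n K \<longleftrightarrow> (\<forall>b::bool. P (K b) \<and> K b \<subseteq> D \<and>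
      (\<forall>x\<in>K b. \<forall>y\<in>K b. dist x y < inverse (real (Suc n)))) \<and> f ` K True \<inter> f ` K False = {}"
    for D n K
  \<comment> \<open>The split is fixed once for each \<open>D\<close> and \<open>n\<close>, so
    branches coincide as long as their sets agree.\<close>
  define g where "g D n = (SOME K. Q D n K)" for D n
  have Qg: "Q D n (g D n)" if "P D" for D n
  proof -
    have "closed D" "uncountable (f ` D)" "inverse (real (Suc n)) > 0"
      using that by (simp_all add: P_def)
    from uncountable_image_split[OF f this] obtain K where "\<forall>b::bool. closed (K b) \<and> K b \<subseteq> D \<and> uncountable (f ` K b) \<and>
          (\<forall>x\<in>K b. \<forall>y\<in>K b. dist x y < inverse (real (Suc n)))"
        "f ` K True \<inter> f ` K False = {}"
      by (elim exE conjE)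
    then have "Q D n K" unfolding P_def Q_def by simp
    then show ?thesis unfolding g_def by (rule someI[of "Q D n"])
  qed
  have g: "P (g D n b)" "g D n b \<subseteq> D"
      "x \<in> g D n b \<Longrightarrow> y \<in> g D n b \<Longrightarrow> dist x y < inverse (real (Suc n))"
      "f ` g D n True \<inter> f ` g D n False = {}" if "P D" for D n b x y
    using Qg[OF that, of n] unfolding Q_def by simp_all
  define K where "K B = rec_nat C (\<lambda>n D. g D n (n \<in> B))" for B
  have K_Suc: "K B (Suc n) = g (K B n) n (n \<in> B)" and K_0: "K B 0 = C" for B n
    by (simp_all add: K_def)
  have PK: "P (K B n)" for B n
    by (induction n) (use C in \<open>auto simp: K_Suc K_0 P_def[of C] intro: g(1)\<close>)
  have mono: "K B n \<subseteq> K B m" if "m \<le> n" for B m n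
    using that by (rule lift_Suc_antimono_le[rotated]) (simp add: K_Suc g(2) PK)
  have "\<exists>a. \<forall>n. a \<in> K B n" for B
  proof (rule decreasing_closed_nest[of "K B"])
    show "closed (K B n)" for n using PK[of B n] by (simp add: P_def)
    show "K B n \<noteq> {}" for n using PK[of B n] by (auto simp: P_def)
    fix \<epsilon> :: real assume "\<epsilon> > 0"
    then obtain n where "inverse (Suc n) < \<epsilon>" using reals_Archimedean by blast
    then have "dist x y < \<epsilon>" if "x \<in> K B (Suc n)" "y \<in> K B (Suc n)" for x y
      using g(3)[OF PK[of B n], of x n _ y] that by (fastforce simp: K_Suc)
    then show "\<exists>n. \<forall>x\<in>K B n. \<forall>y\<in>K B n. dist x y < \<epsilon>" by blast
  qed (use mono in blast)+
  then obtain p where p: "\<And>B n. p B \<in> K B n" by metis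
  have "f (p A) \<noteq> f (p B)" if "A \<noteq> B" for A B
  proof -
    have "\<exists>n. (n \<in> A) \<noteq> (n \<in> B)" using that by blast
    then obtain n where n: "(n \<in> A) \<noteq> (n \<in> B)" "\<And>m. m < n \<Longrightarrow> (m \<in> A) = (m \<in> B)"
      using exists_least_iff[of "\<lambda>n. (n \<in> A) \<noteq> (n \<in> B)"] by blast
    have "K A m = K B m" if "m \<le> n" for m
      using that by (induction m) (simp_all add: K_0 K_Suc n(2))
    then have "K A n = K B n" by simp
    then show ?thesis
      using p[of A "Suc n"] p[of B "Suc n"] n(1) g(4)[OF PK[of A n], of n]
      by (cases "n \<in> A") (auto simp: K_Suc)
  qed
  then have "inj (\<lambda>B. f (p B))" by (meson injI)
  moreover have "range (\<lambda>B. f (p B)) \<subseteq> f ` C" using p[of _ 0] by (auto simp: K_0)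
  ultimately show ?thesis unfolding lepoll_def by blast
qed

lemma nat_sets_lepoll_uncountable_borel:
  fixes A :: "'a::polish_space set"
  assumes "A \<in> sets borel" "uncountable A"
  shows "(UNIV :: nat set set) \<lesssim> A"
proof -
  obtain C :: "('a \<times> (nat \<Rightarrow> real)) set" where "closed C" "A = fst ` C"
    using borel_imp_analytic[OF assms(1)] unfolding analytic_def by blast
  then show ?thesis
    using nat_sets_lepoll_uncountable_image[OF continuous_on_fst[OF continuous_on_id]] assms(2) by blast
qed

section \<open>Non-Borel sets of reals of bounded cardinality\<close>

text \<open>A diagonal argument: coding closed subsets of \<open>\<real> \<times> \<real>\<^sup>\<nat>\<close> by reals, the set
  \<open>S\<close> of those codes that do not belong to the analytic set they code is not analytic.\<close>

lemma exists_not_borel_real: "\<exists>S :: real set. S \<notin> sets borel"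
proof -
  obtain U :: "nat \<Rightarrow> (real \<times> (nat \<Rightarrow> real)) set"
    where U: "\<And>n. open (U n)" "\<And>W x. open W \<Longrightarrow> x \<in> W \<Longrightarrow> \<exists>n. x \<in> U n \<and> U n \<subseteq> W"
  proof -
    obtain \<B> :: "(real \<times> (nat \<Rightarrow> real)) set set" where \<B>: "countable \<B>" "topological_basis \<B>"
      using ex_countable_basis by blast
    have "\<B> \<noteq> {}" using \<B>(2) topological_basisE[of \<B> UNIV] by blast
    then have "range (from_nat_into \<B>) = \<B>" using \<B>(1) by (rule range_from_nat_into)
    then have mem: "B \<in> \<B> \<longleftrightarrow> (\<exists>n. B = from_nat_into \<B> n)" for B by blast
    show ?thesis
    proof (rule that[of "from_nat_into \<B>"])
      show "open (from_nat_into \<B> n)" for n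
        using topological_basis_open[OF \<B>(2)] mem by blast
      show "\<exists>n. x \<in> from_nat_into \<B> n \<and> from_nat_into \<B> n \<subseteq> W" if "open W" "x \<in> W" for W x
        using topological_basisE[OF \<B>(2) that] mem by metis
    qed
  qed
  obtain c :: "real \<Rightarrow> nat set" where c: "surj c"
    using eqpoll_sym[OF nat_sets_eqpoll_reals] unfolding eqpoll_def bij_betw_def by blast
  \<comment> \<open>\<open>c y\<close> codes the closed set of points outside every
    \<open>U n\<close> with \<open>n \<in> c y\<close>; \<open>y \<in> S\<close> says that no point
    of that set lies over \<open>y\<close>.\<close>
  define S where "S = {y. \<forall>z. \<exists>n\<in>c y. (y, z) \<in> U n}"
  have False if "S \<in> sets borel"
  proof -
    obtain C :: "(real \<times> (nat \<Rightarrow> real)) set" where C: "closed C" "S = fst ` C"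
      using borel_imp_analytic[OF \<open>S \<in> sets borel\<close>] unfolding analytic_def by blast
    \<comment> \<open>A code of \<open>C\<close> itself: all basic sets disjoint from
      \<open>C\<close>, whose union is \<open>- C\<close>.\<close>
    obtain y where y: "{n. U n \<inter> C = {}} = c y" by (rule surjE[OF c])
    have "(\<exists>n\<in>c y. (y, z) \<in> U n) \<longleftrightarrow> (y, z) \<notin> C" for z
    proof
      show "(y, z) \<notin> C" if "\<exists>n\<in>c y. (y, z) \<in> U n" using that unfolding y[symmetric] by blast
      assume "(y, z) \<notin> C"
      then obtain n where "(y, z) \<in> U n" "U n \<subseteq> - C"
        using U(2)[of "- C" "(y, z)"] C(1) by (auto simp: open_Compl)
      then show "\<exists>n\<in>c y. (y, z) \<in> U n" unfolding y[symmetric] by blast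
    qed
    then have "y \<in> S \<longleftrightarrow> y \<notin> fst ` C" unfolding S_def by force
    then show False using C(2) by blast
  qed
  then show ?thesis by blast
qed

text \<open>If \<open>D\<close> has at least continuum many points, any non-Borel set fits.
  Otherwise \<open>D\<close> embeds into the reals, and its uncountable image is too small to be
  Borel by the perfect set property.\<close>

lemma exists_not_borel_lepoll:
  assumes "uncountable D"
  shows "\<exists>S :: real set. S \<notin> sets borel \<and> S \<lesssim> D"
proof (cases "(UNIV :: nat set set) \<lesssim> D")
  case True
  obtain S :: "real set" where "S \<notin> sets borel" using exists_not_borel_real by blast
  moreover have "S \<lesssim> D"
    using True nat_sets_eqpoll_reals subset_imp_lepoll[of S UNIV]
    by (meson eqpoll_imp_lepoll eqpoll_sym lepoll_trans subset_UNIV)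
  ultimately show ?thesis by blast
next
  case False
  have "D \<lesssim> (UNIV :: nat set set)"
    using False ordLeq_total[OF card_of_Well_order card_of_Well_order, of D "UNIV :: nat set set"]
    unfolding lepoll_def card_of_ordLeq[symmetric] by blast
  then have "D \<lesssim> (UNIV :: real set)"
    using nat_sets_eqpoll_reals by (meson eqpoll_imp_lepoll lepoll_trans)
  then obtain f :: "'a \<Rightarrow> real" where f: "inj_on f D" unfolding lepoll_def by blast
  then have eq: "f ` D \<approx> D" using inj_on_image_eqpoll_self by blast
  have "f ` D \<notin> sets borel"
  proof
    assume "f ` D \<in> sets borel"
    moreover have "uncountable (f ` D)" using assms f countable_image_inj_on by blast
    ultimately have "(UNIV :: nat set set) \<lesssim> f ` D" by (rule nat_sets_lepoll_uncountable_borel)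
    then show False using False eq by (meson eqpoll_imp_lepoll lepoll_trans)
  qed
  then show ?thesis using eq eqpoll_imp_lepoll by blast
qed

text \<open>With \<open>D\<close> identified with \<open>D \<times> D\<close>, a map that forgets
  the second coordinate has a second point in each fibre.\<close>

lemma exists_not_borel_range_two_to_one:
  assumes "uncountable D"
  obtains s :: "'a \<Rightarrow> real" where "s ` D \<notin> sets borel"
    and "\<And>i. i \<in> D \<Longrightarrow> \<exists>j\<in>D. j \<noteq> i \<and> s j = s i"
proof -
  obtain S :: "real set" where S: "S \<notin> sets borel" "S \<lesssim> D"
    using exists_not_borel_lepoll[OF assms] by blast
  \<comment> \<open>The empty set is Borel. Nonemptiness turns the injection of \<open>S\<close>
    into \<open>D\<close> into a surjection of \<open>D\<close> onto \<open>S\<close>.\<close>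
  then have "S \<noteq> {}" by auto
  moreover obtain h where h: "inj_on h S" "h ` S \<subseteq> D" using S(2) unfolding lepoll_def by blast
  ultimately obtain g where g: "g ` D = S"
    by (metis inj_on_iff_surj)
  have inf: "infinite D" using assms uncountable_infinite by blast
  obtain b where b: "bij_betw b (D \<times> D) D"
    using card_of_Times_same_infinite[OF inf] unfolding card_of_ordIso[symmetric] by blast
  define s where "s i = g (fst (inv_into (D \<times> D) b i))" for i
  have s: "s (b (i, j)) = g i" if "i \<in> D" "j \<in> D" for i j
    using that bij_betw_inv_into_left[OF b] by (simp add: s_def)
  have D: "\<exists>i'\<in>D. \<exists>j'\<in>D. i = b (i', j')" if "i \<in> D" for i
    using that b unfolding bij_betw_def by force
  have bD: "b (i, j) \<in> D" if "i \<in> D" "j \<in> D" for i j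
    using that b by (auto simp: bij_betw_def)
  have "s ` D = g ` D"
  proof (intro equalityI subsetI)
    fix x assume "x \<in> s ` D" then show "x \<in> g ` D" using D s by force
  next
    fix x assume "x \<in> g ` D" then show "x \<in> s ` D" using bD s by force
  qed
  moreover have "\<exists>j\<in>D. j \<noteq> i \<and> s j = s i" if i: "i \<in> D" for i
  proof -
    obtain i' j' where ij: "i' \<in> D" "j' \<in> D" "i = b (i', j')" using D[OF i] by blast
    obtain k where k: "k \<in> D" "k \<noteq> j'"
      using inf by (metis finite.emptyI finite.insertI infinite_super insertI1 subsetI)
    have "b (i', k) \<noteq> i" using b k ij unfolding bij_betw_def inj_on_def by blast
    then show ?thesis using bD[OF ij(1) k(1)] s[OF ij(1) k(1)] s[OF ij(1,2)] ij(3) by auto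
  qed
  ultimately show ?thesis using that[of s] S(1) g by simp
qed

section \<open>Shortcuts through a hub\<close>

text \<open>If all separated sets were countable, the union of maximal ones, one for each scale
  \<open>inverse (Suc n)\<close>, would be a countable dense set: a point farther than the scale
  from a maximal set could be added to it.\<close>

lemma (in Metric_space) uncountable_separated_subset:
  assumes "\<not> separable_space mtopology"
  obtains D \<epsilon> where "D \<subseteq> M" "uncountable D" "\<epsilon> > 0"
    "\<And>x y. x \<in> D \<Longrightarrow> y \<in> D \<Longrightarrow> x \<noteq> y \<Longrightarrow> \<epsilon> \<le> d x y"
proof (rule ccontr)
  define A where "A n = {D. D \<subseteq> M \<and> (\<forall>x\<in>D. \<forall>y\<in>D. x \<noteq> y \<longrightarrow> inverse (real (Suc n)) \<le> d x y)}" for n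
  note witness = that
  assume no: "\<not> thesis"
  have count: "countable D" if D: "D \<in> A n" for D n
  proof (rule ccontr)
    assume "uncountable D"
    then show False
      using D no witness[of D "inverse (real (Suc n))"] unfolding A_def by auto
  qed
  have "\<exists>D\<in>A n. \<forall>E\<in>A n. D \<subseteq> E \<longrightarrow> E = D" for n
  proof (rule subset_Zorn')
    fix \<C> assume "subset.chain (A n) \<C>"
    then have sub: "\<C> \<subseteq> A n" and lin: "\<And>D E. D \<in> \<C> \<Longrightarrow> E \<in> \<C> \<Longrightarrow> D \<subseteq> E \<or> E \<subseteq> D"
      by (auto simp: subset_chain_def)
    have "inverse (real (Suc n)) \<le> d x y" if xy: "x \<in> \<Union>\<C>" "y \<in> \<Union>\<C>" "x \<noteq> y" for x y
    proof -
      obtain D E where DE: "D \<in> \<C>" "x \<in> D" "E \<in> \<C>" "y \<in> E" using xy by blast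
      then obtain F where "F \<in> \<C>" "x \<in> F" "y \<in> F" using lin[of D E] by blast
      then show ?thesis using sub xy(3) unfolding A_def by blast
    qed
    moreover have "\<Union>\<C> \<subseteq> M" using sub unfolding A_def by blast
    ultimately show "\<Union>\<C> \<in> A n" unfolding A_def by blast
  qed
  then have "\<exists>F. \<forall>n. F n \<in> A n \<and> (\<forall>E\<in>A n. F n \<subseteq> E \<longrightarrow> E = F n)"
    by (intro choice) (simp add: Bex_def)
  then obtain F where F: "\<forall>n. F n \<in> A n \<and> (\<forall>E\<in>A n. F n \<subseteq> E \<longrightarrow> E = F n)" ..
  have FA: "F n \<in> A n" for n
    using F[rule_format, of n] by (rule conjunct1)
  have Fmax: "E = F n" if "E \<in> A n" "F n \<subseteq> E" for n E
    using F[rule_format, of n, THEN conjunct2] that by blast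
  have "\<exists>y\<in>\<Union>(range F). y \<in> mball x r" if x: "x \<in> M" and r: "r > 0" for x r
  proof -
    obtain n where n: "inverse (real (Suc n)) < r" using reals_Archimedean[OF r] by blast
    have FM: "F n \<subseteq> M" using FA[of n] by (simp add: A_def)
    have "\<exists>y\<in>F n. d x y < r"
    proof (rule ccontr)
      assume *: "\<not> ?thesis"
      have far: "inverse (real (Suc n)) \<le> d x y" if "y \<in> F n" for y
      proof -
        have "\<not> d x y < r" using * that by blast
        then show ?thesis using n by linarith
      qed
      have sep: "inverse (real (Suc n)) \<le> d y z" if "y \<in> F n" "z \<in> F n" "y \<noteq> z" for y z
        using FA[of n] that unfolding A_def by blast
      have "inverse (real (Suc n)) \<le> d y z" if "y \<in> insert x (F n)" "z \<in> insert x (F n)" "y \<noteq> z" for y z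
        using that far[of y] far[of z] sep[of y z] commute[of x y] by (elim insertE) simp_all
      then have "insert x (F n) \<in> A n"
        unfolding A_def using FM x by blast
      then have "insert x (F n) = F n" by (rule Fmax) blast
      then have "x \<in> F n" by blast
      moreover have "d x x < r" using x r by simp
      ultimately show False using * by blast
    qed
    then show ?thesis using x FM by auto
  qed
  then have "mtopology closure_of (\<Union>(range F)) = M"
    unfolding metric_closure_of by blast
  moreover have "countable (\<Union>(range F))"
    using count[OF FA] by (intro countable_UN) auto
  moreover have "\<Union>(range F) \<subseteq> M" using FA by (auto simp: A_def)
  ultimately show False using assms unfolding separable_space_def topspace_mtopology by blast
qed

text \<open>Infimum of route lengths from \<open>x\<close> to the hub, \<open>w i\<close> being the
  length of the edge that joins \<open>i\<close> to the hub.\<close>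

definition hub_dist :: "('a \<Rightarrow> 'a \<Rightarrow> real) \<Rightarrow> 'a set \<Rightarrow> ('a \<Rightarrow> real) \<Rightarrow> 'a \<Rightarrow> real" where
  "hub_dist d D w x = (INF i\<in>D. d x i + w i)"

text \<open>\<open>u\<close> stands for the distance to the hub; the cheaper of the direct route and
  the detour counts.\<close>

definition via_hub :: "('a \<Rightarrow> 'a \<Rightarrow> real) \<Rightarrow> 'a set \<Rightarrow> ('a \<Rightarrow> real) \<Rightarrow> 'a \<Rightarrow> 'a \<Rightarrow> real" where
  "via_hub d M u x y = (if x \<in> M \<and> y \<in> M then min (d x y) (u x + u y) else 0)"

text \<open>Serves both Lipschitz estimates: \<open>c = 0\<close> for moving the point,
  \<open>a = 0\<close> for changing the edge lengths.\<close>

lemma hub_dist_perturb: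
  assumes "D \<noteq> {}" "\<And>x y. 0 \<le> d x y" "\<And>i. i \<in> D \<Longrightarrow> 0 \<le> w i" "\<And>i. i \<in> D \<Longrightarrow> w i \<le> w' i + c"
    and "\<And>i. i \<in> D \<Longrightarrow> d x i \<le> d y i + a"
  shows "hub_dist d D w x \<le> hub_dist d D w' y + (a + c)"
proof -
  have bdd: "bdd_below ((\<lambda>i. d x i + w i) ` D)"
    by (rule bdd_belowI2[of _ 0]) (use assms in force)
  have "hub_dist d D w x - (a + c) \<le> d y i + w' i" if i: "i \<in> D" for i
  proof -
    have "hub_dist d D w x \<le> d x i + w i"
      unfolding hub_dist_def by (rule cINF_lower[OF bdd i])
    then show ?thesis using assms(4,5)[OF i] by linarith
  qed
  then have "hub_dist d D w x - (a + c) \<le> hub_dist d D w' y"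
    unfolding hub_dist_def by (intro cINF_greatest assms(1))
  then show ?thesis by simp
qed

context Metric_space
begin

lemma hub_dist_eq_0:
  assumes "i \<in> D" "D \<subseteq> M" "\<And>i. i \<in> D \<Longrightarrow> 0 \<le> w i" "w i = 0"
  shows "hub_dist d D w i = 0"
proof (rule antisym)
  have bdd: "bdd_below ((\<lambda>j. d i j + w j) ` D)"
    by (rule bdd_belowI2[of _ 0]) (use assms in force)
  show "hub_dist d D w i \<le> 0"
    using cINF_lower[OF bdd assms(1)] assms(1,2,4) unfolding hub_dist_def by auto
  show "0 \<le> hub_dist d D w i"
    unfolding hub_dist_def using assms(1,3) by (intro cINF_greatest) auto
qed

text \<open>At most one point of \<open>D\<close> lies within \<open>\<epsilon> / 2\<close> of
  \<open>x\<close>; its edge has positive length, and every other route costs at least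
  \<open>\<epsilon> / 2\<close>. This bounds the infimum away from 0.\<close>

lemma hub_dist_pos:
  assumes "D \<noteq> {}" "D \<subseteq> M" "\<And>i. i \<in> D \<Longrightarrow> 0 < w i" "\<epsilon> > 0" "x \<in> M"
    and sep: "\<And>i j. i \<in> D \<Longrightarrow> j \<in> D \<Longrightarrow> i \<noteq> j \<Longrightarrow> \<epsilon> \<le> d i j"
  shows "0 < hub_dist d D w x"
proof (cases "\<exists>i\<in>D. d x i < \<epsilon> / 2")
  case True
  then obtain i where i: "i \<in> D" "d x i < \<epsilon> / 2" by blast
  have "min (w i) (\<epsilon> / 2) \<le> d x j + w j" if j: "j \<in> D" for j
  proof (cases "j = i")
    case False
    have "d i j \<le> d x i + d x j"
      using triangle[of i x j] commute[of i x] i(1) j assms(2,5) by auto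
    then show ?thesis using sep[OF i(1) j] False i(2) assms(3)[OF j] by auto
  qed (simp add: min.coboundedI1)
  then have "min (w i) (\<epsilon> / 2) \<le> hub_dist d D w x"
    unfolding hub_dist_def by (intro cINF_greatest assms(1))
  then show ?thesis using assms(3)[OF i(1)] assms(4) by linarith
next
  case False
  then have "\<epsilon> / 2 \<le> d x j + w j" if "j \<in> D" for j
    using assms(3)[OF that] that by force
  then have "\<epsilon> / 2 \<le> hub_dist d D w x"
    unfolding hub_dist_def by (intro cINF_greatest assms(1))
  then show ?thesis using assms(4) by linarith
qed

lemma via_hub_in_CPM:
  assumes u: "\<And>x. x \<in> M \<Longrightarrow> 0 \<le> u x" "\<And>x y. x \<in> M \<Longrightarrow> y \<in> M \<Longrightarrow> u x \<le> u y + d x y"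
  shows "via_hub d M u \<in> CPM mtopology"
proof -
  have "Lipschitz_continuous_map (metric (M, d)) euclidean_metric u"
    unfolding Lipschitz_continuous_map_def
  proof (intro conjI exI[of _ 1] ballI)
    fix x y assume "x \<in> mspace (metric (M, d))" "y \<in> mspace (metric (M, d))"
    then show "mdist euclidean_metric (u x) (u y) \<le> 1 * mdist (metric (M, d)) x y"
      using u(2)[of x y] u(2)[of y x] commute[of x y] by (auto simp: dist_real_def)
  qed auto
  then have cu: "continuous_map mtopology euclideanreal u"
    using Lipschitz_continuous_imp_continuous_map by fastforce
  have "continuous_map (prod_topology mtopology mtopology) euclideanreal (\<lambda>p. u (fst p) + u (snd p))"
    by (intro continuous_map_add continuous_map_compose[OF continuous_map_fst cu, unfolded o_def]
        continuous_map_compose[OF continuous_map_snd cu, unfolded o_def])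
  moreover have "continuous_map (prod_topology mtopology mtopology) euclideanreal (\<lambda>p. d (fst p) (snd p))"
    using continuous_map_mdist[of "prod_topology mtopology mtopology" "metric (M, d)" fst snd]
    by (simp add: continuous_map_fst continuous_map_snd)
  ultimately have
    "continuous_map (prod_topology mtopology mtopology) euclideanreal
      (\<lambda>p. min (d (fst p) (snd p)) (u (fst p) + u (snd p)))"
    by (rule continuous_map_real_min[rotated])
  then have "continuous_map (prod_topology mtopology mtopology) euclideanreal (\<lambda>(x, y). via_hub d M u x y)"
    by (rule continuous_map_eq) (auto simp: via_hub_def)
  \<comment> \<open>Two direct legs use the triangle inequality of \<open>d\<close>, a direct leg
    and a hub leg the Lipschitz bound on \<open>u\<close>, and two hub legs the nonnegativity of
    \<open>u y\<close>.\<close>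
  moreover have "via_hub d M u x z \<le> via_hub d M u x y + via_hub d M u y z"
    if "x \<in> M" "y \<in> M" "z \<in> M" for x y z
    using that triangle[OF that] u(2)[of x y] u(2)[of z y] u(1)[of y] commute[of z y]
    by (auto simp: via_hub_def min_def)
  moreover have "0 \<le> via_hub d M u x y" "via_hub d M u x y = via_hub d M u y x" for x y
    using u(1) by (simp_all add: via_hub_def commute add.commute)
  moreover have "via_hub d M u x x = 0" if "x \<in> M" for x
    using u(1)[OF that] that by (simp add: via_hub_def)
  moreover have "zero_outside M (via_hub d M u)"
    by (simp add: zero_outside_def via_hub_def)
  ultimately show ?thesis
    unfolding CPM_def continuous_pseudometric_def by simp
qed

text \<open>A detour from \<open>x\<close> costs more than \<open>u x\<close>, so for radii up to
  \<open>u x\<close> the new balls at \<open>x\<close> equal the old ones; positivity of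
  \<open>u\<close> also separates points.\<close>

lemma via_hub_in_Met:
  assumes u: "\<And>x. x \<in> M \<Longrightarrow> 0 < u x" "\<And>x y. x \<in> M \<Longrightarrow> y \<in> M \<Longrightarrow> u x \<le> u y + d x y"
  shows "via_hub d M u \<in> Met mtopology"
proof -
  let ?e = "via_hub d M u"
  have e: "?e \<in> CPM mtopology"
    using via_hub_in_CPM[of u] u by (simp add: less_imp_le)
  have M: "Metric_space M ?e"
  proof
    show "0 \<le> ?e x y" for x y using u(1) by (auto simp: via_hub_def add_nonneg_nonneg less_imp_le)
    show "?e x y = ?e y x" for x y by (simp add: via_hub_def commute add.commute)
    show "?e x z \<le> ?e x y + ?e y z" if "x \<in> M" "y \<in> M" "z \<in> M" for x y z
      using e that by (simp add: CPM_def continuous_pseudometric_def)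
    show "?e x y = 0 \<longleftrightarrow> x = y" if "x \<in> M" "y \<in> M" for x y
      using that u(1)[of x] u(1)[of y] by (auto simp: via_hub_def min_def)
  qed
  interpret E: Metric_space M ?e by (rule M)
  have ball: "E.mball x r = mball x r" if "x \<in> M" "r \<le> u x" for x r
  proof -
    have "?e x y < r \<longleftrightarrow> d x y < r" if "y \<in> M" for y
      using \<open>x \<in> M\<close> \<open>r \<le> u x\<close> that u(1)[OF that] by (auto simp: via_hub_def)
    then show ?thesis unfolding E.mball_def mball_def by auto
  qed
  have "(\<exists>r>0. E.mball x r \<subseteq> U) \<longleftrightarrow> (\<exists>r>0. mball x r \<subseteq> U)" if "x \<in> M" for x U
  proof -
    have shrink: "\<exists>r>0. r \<le> u x \<and> B r \<subseteq> U" if "s > 0" "B s \<subseteq> U" "mono B" for B :: "real \<Rightarrow> 'a set" and s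
      using that u(1)[OF \<open>x \<in> M\<close>] monoD[OF that(3), of "min s (u x)" s]
      by (intro exI[of _ "min s (u x)"]) auto
    have "mono (mball x)" "mono (E.mball x)" by (auto simp: mono_def)
    then show ?thesis
      using shrink ball[OF \<open>x \<in> M\<close>] by metis
  qed
  then have "openin E.mtopology U \<longleftrightarrow> openin mtopology U" for U
    unfolding E.openin_mtopology openin_mtopology by (meson subsetD)
  then have "E.mtopology = mtopology" by (simp add: topology_eq)
  then show ?thesis using M by (simp add: Met_def zero_outside_def via_hub_def)
qed

end

lemma cpm_sup_via_hub_le:
  assumes "\<And>x. x \<in> topspace X \<Longrightarrow> \<bar>u x - v x\<bar> \<le> c"
  shows "cpm_sup X (via_hub d M u) (via_hub d M v) \<le> ennreal (2 * c)"
  unfolding cpm_sup_def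
proof (intro SUP_least)
  fix p assume "p \<in> topspace X \<times> topspace X"
  then obtain x y where p: "p = (x, y)" "x \<in> topspace X" "y \<in> topspace X" by blast
  have "\<bar>via_hub d M u x y - via_hub d M v x y\<bar> \<le> 2 * c"
    using assms[OF p(2)] assms[OF p(3)] by (auto simp: via_hub_def min_def)
  then show "(case p of (x, y) \<Rightarrow> ennreal \<bar>via_hub d M u x y - via_hub d M v x y\<bar>) \<le> ennreal (2 * c)"
    using p(1) by (simp add: ennreal_leI)
qed

section \<open>Non-separable spaces\<close>

lemma borel_vimage_cpm:
  fixes F :: "real \<Rightarrow> 'a \<Rightarrow> 'a \<Rightarrow> real"
  assumes F: "\<And>t. F t \<in> CPM X" "\<And>t t'. cpm_sup X (F t) (F t') \<le> ennreal (2 * \<bar>t - t'\<bar>)"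
    and A: "A \<in> borel_sets_of (cpm_topology X)"
  shows "F -` A \<in> sets borel"
proof -
  have "A \<in> sigma_sets (CPM X) {U. openin (cpm_topology X) U}"
    using A by (simp add: borel_sets_of_def topspace_cpm_topology)
  then show ?thesis
  proof induction
    case (Basic U)
    then have U: "openin (cpm_topology X) U" by simp
    have "open (F -` U)"
      unfolding open_dist
    proof
      fix t assume "t \<in> F -` U"
      then have "F t \<in> U" by simp
      then obtain r where r: "r > 0" "\<And>e. e \<in> CPM X \<Longrightarrow> cpm_sup X (F t) e < ennreal r \<Longrightarrow> e \<in> U"
        using U unfolding openin_cpm_topology by blast
      have "F t' \<in> U" if "dist t' t < r / 2" for t'
      proof (rule r(2)[OF F(1)])
        have "cpm_sup X (F t) (F t') \<le> ennreal (2 * \<bar>t - t'\<bar>)" by (rule F(2))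
        also have "\<dots> < ennreal r"
          using that r(1) by (simp add: ennreal_less_iff dist_real_def abs_minus_commute mult.commute)
        finally show "cpm_sup X (F t) (F t') < ennreal r" .
      qed
      then show "\<exists>\<delta>>0. \<forall>t'. dist t' t < \<delta> \<longrightarrow> t' \<in> F -` U"
        using r(1) by (intro exI[of _ "r / 2"]) simp
    qed
    then show ?case by simp
  next
    case (Compl B)
    \<comment> \<open>The relative complement pulls back to the full one because \<open>F\<close>
      takes all its values in \<open>CPM X\<close>.\<close>
    have "F -` (CPM X - B) = - (F -` B)" using F(1) by auto
    then show ?case using Compl.IH by (simp add: borel_comp)
  next
    case (Union B)
    then show ?case by (auto simp: vimage_UN)
  qed simp
qed

theorem theorem3p5:
  fixes X :: "'a topology"
  assumes "metrizable_space X"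
    and "Met X \<in> borel_sets_of (cpm_topology X)"
  shows "separable_space X"
proof (rule ccontr)
  assume nonsep: "\<not> separable_space X"
  obtain M d where "Metric_space M d" and X: "X = Metric_space.mtopology M d"
    using assms(1) unfolding metrizable_space_def by blast
  then interpret Metric_space M d by simp
  obtain D \<epsilon> where D: "D \<subseteq> M" "uncountable D" "\<epsilon> > 0"
    "\<And>x y. x \<in> D \<Longrightarrow> y \<in> D \<Longrightarrow> x \<noteq> y \<Longrightarrow> \<epsilon> \<le> d x y"
    using nonsep unfolding X by (rule uncountable_separated_subset) blast
  have ne: "D \<noteq> {}" using D(2) by auto
  obtain s :: "'a \<Rightarrow> real" where s: "s ` D \<notin> sets borel"
    "\<And>i. i \<in> D \<Longrightarrow> \<exists>j\<in>D. j \<noteq> i \<and> s j = s i"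
    using exists_not_borel_range_two_to_one[OF D(2)] by blast
  define u where "u t = hub_dist d D (\<lambda>i. \<bar>t - s i\<bar>)" for t
  have lip: "u t x \<le> u t y + d x y" if "x \<in> M" "y \<in> M" for t x y
  proof -
    have "d x i \<le> d y i + d x y" if "i \<in> D" for i
      using triangle[of x y i] \<open>x \<in> M\<close> \<open>y \<in> M\<close> D(1) that by auto
    then show ?thesis
      unfolding u_def
      by (intro order_trans[OF hub_dist_perturb[OF ne, where c = 0 and a = "d x y" and y = y]]) auto
  qed
  have lip_t: "u t x \<le> u t' x + \<bar>t - t'\<bar>" for t t' x
    unfolding u_def
    by (rule order_trans[OF hub_dist_perturb[OF ne, where c = "\<bar>t - t'\<bar>" and a = 0 and y = x]]) auto
  have nonneg_u: "0 \<le> u t x" for t x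
    unfolding u_def hub_dist_def by (intro cINF_greatest ne) simp
  define F where "F t = via_hub d M (u t)" for t
  have F: "F t \<in> CPM X" for t
    unfolding F_def X by (intro via_hub_in_CPM nonneg_u lip)
  have "\<bar>u t x - u t' x\<bar> \<le> \<bar>t - t'\<bar>" for t t' x
    using lip_t[of t x t'] lip_t[of t' x t] abs_minus_commute[of t' t] by linarith
  then have "cpm_sup X (F t) (F t') \<le> ennreal (2 * \<bar>t - t'\<bar>)" for t t'
    unfolding F_def by (rule cpm_sup_via_hub_le)
  then have borel: "F -` Met X \<in> sets borel"
    by (rule borel_vimage_cpm[OF F _ assms(2)])
  have "F t \<in> Met X \<longleftrightarrow> t \<notin> s ` D" for t
  proof
    assume "t \<notin> s ` D"
    \<comment> \<open>The edge lengths are positive but may have infimum 0; separation of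
      \<open>D\<close> still makes \<open>u t\<close> positive.\<close>
    then have "0 < \<bar>t - s i\<bar>" if "i \<in> D" for i using that by force
    then have "0 < u t x" if "x \<in> M" for x
      unfolding u_def using that D(4) by (rule hub_dist_pos[OF ne D(1) _ D(3)])
    then show "F t \<in> Met X"
      unfolding F_def X by (intro via_hub_in_Met lip)
  next
    assume "F t \<in> Met X"
    then interpret E: Metric_space M "F t" by (simp add: Met_def X)
    show "t \<notin> s ` D"
    proof
      assume "t \<in> s ` D"
      then obtain i where i: "i \<in> D" "t = s i" by blast
      \<comment> \<open>Two-point fibres enter here: \<open>i\<close> and \<open>j\<close> are both
        at distance 0 from the hub, so the detour between them is free.\<close>
      obtain j where j: "j \<in> D" "j \<noteq> i" "s j = s i" using s(2)[OF i(1)] by blast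
      have "u t i = 0" "u t j = 0"
        unfolding u_def using i j by (simp_all add: hub_dist_eq_0[OF _ D(1)])
      moreover have "i \<in> M" "j \<in> M" using i(1) j(1) D(1) by auto
      ultimately have "F t i j = 0" by (simp add: F_def via_hub_def)
      then show False using E.zero[OF \<open>i \<in> M\<close> \<open>j \<in> M\<close>] j(2) by simp
    qed
  qed
  then have "F -` Met X = - (s ` D)" by blast
  then have "s ` D \<in> sets borel" using borel_comp[OF borel] by simp
  then show False using s(1) by blast
qed

end
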